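(* Let $\alpha\in(0,1)$, $b>0$ and $y_0\in\mathbb{R}$. If the function $f:[0,b]\times\mathbb{R}\to\mathbb{R}$ is continuous at $(0,y_0)$ and satisfies the inequality $$x^\alpha\,|f(x,y_1)-f(x,y_2)|\le\Gamma(\alpha+1)\,|y_1-y_2|$$ for all $x\in[0,b]$ and all $y_1,y_2\in\mathbb{R}$, then the initial value problem $$D_{*0}^\alpha y(x)=f(x,y(x)),\qquad y(0)=y_0,$$ has at most one continuous solution $y$ on $[0,b]$ satisfying $D_{*0}^\alpha y\in C[0,b]$.
   Context: All functions are real-valued. For $\beta>0$ the Riemann-Liouville integral operator with starting point $0$ is $J_0^\beta h(x):=\frac{1}{\Gamma(\beta)}\int_0^x (x-t)^{\beta-1}h(t)\,\mathrm{d}t$ for $x\ge 0$. For $\alpha\in(0,1)$ the Caputo derivative of order $\alpha$ with starting point $0$ is $$D_{*0}^\alpha y:=D\,J_0^{1-\alpha}\bigl[y-y(0)\bigr],$$ where $D$ is the classical first derivative (one-sided at interval endpoints). A solution on $[0,b]$ is a function $y$ on $[0,b]$ with $y(0)=y_0$ that satisfies the differential equation for $x\in[0,b]$. *)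

theory Defs
  imports "HOL-Analysis.Analysis"
begin

(* Henstock-Kurzweil integral; it agrees with the Lebesgue integral whenever the
   integrand is absolutely integrable, in particular for h continuous on {0..x}.
   The kernel value at t = x is 0 for beta < 1 (0 powr a = 0), which only affects a null set. *)
definition RL_integral :: "real \<Rightarrow> (real \<Rightarrow> real) \<Rightarrow> real \<Rightarrow> real" where
  "RL_integral \<beta> h x =
     1 / Gamma \<beta> * integral {0..x} (\<lambda>t. (x - t) powr (\<beta> - 1) * h t)"

(* Functions on [0,b] are total functions of which only the values on {0..b} matter.
   The filter "at x within {0..b}" makes the derivative one-sided at 0 and at b. *)
definition has_caputo_deriv :: "real \<Rightarrow> real \<Rightarrow> (real \<Rightarrow> real) \<Rightarrow> real \<Rightarrow> real \<Rightarrow> bool" where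
  "has_caputo_deriv \<alpha> b y d x \<longleftrightarrow>
     (RL_integral (1 - \<alpha>) (\<lambda>t. y t - y 0) has_real_derivative d) (at x within {0..b})"

(* Meaningful only where the derivative exists; it is then unique for b > 0 and x in {0..b}. *)
definition caputo_deriv :: "real \<Rightarrow> real \<Rightarrow> (real \<Rightarrow> real) \<Rightarrow> real \<Rightarrow> real" where
  "caputo_deriv \<alpha> b y x = (THE d. has_caputo_deriv \<alpha> b y d x)"

(* The equation at x includes the existence of the Caputo derivative at x. *)
definition caputo_ivp_solution ::
    "real \<Rightarrow> real \<Rightarrow> (real \<Rightarrow> real \<Rightarrow> real) \<Rightarrow> real \<Rightarrow> (real \<Rightarrow> real) \<Rightarrow> bool" where
  "caputo_ivp_solution \<alpha> b f y0 y \<longleftrightarrow>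
     y 0 = y0 \<and> (\<forall>x\<in>{0..b}. has_caputo_deriv \<alpha> b y (f x (y x)) x)"

end

theory Submission
  imports Defs
begin

text \<open>
  Two solutions \<open>y\<close> and \<open>z\<close> with the same initial value are compared through the differences
  \<open>w = y - z\<close> and \<open>g x = f x (y x) - f x (z x)\<close>. The second one is the difference of the two Caputo
  derivatives, hence continuous on \<open>[0,b]\<close>, and it vanishes at \<open>0\<close>. There are two ingredients.

  Inversion (\<open>frac_int_inversion\<close>): the equations say that \<open>J\<^sup>1\<^sup>-\<^sup>\<alpha> w\<close> has the derivative \<open>g\<close>, so
  \<open>J\<^sup>1\<^sup>-\<^sup>\<alpha> w = J\<^sup>1 g\<close>. Applying \<open>J\<^sup>\<alpha>\<close> and the semigroup law \<open>J\<^sup>a J\<^sup>c = J\<^sup>a\<^sup>+\<^sup>c\<close>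
  (\<open>frac_int_semigroup\<close>) gives \<open>J\<^sup>1 w = J\<^sup>1 J\<^sup>\<alpha> g\<close>, and differentiation gives \<open>w = J\<^sup>\<alpha> g\<close>.

  Extremality (\<open>frac_int_extremal\<close>): the Nagumo condition turns into
  \<open>x\<^sup>\<alpha> |g x| \<le> \<Gamma>(\<alpha>+1) |J\<^sup>\<alpha> g x|\<close>. Let \<open>M\<close> be the maximum of \<open>|g|\<close>, attained at \<open>c\<close>. If \<open>M > 0\<close>, then
  \<open>c > 0\<close> because \<open>g 0 = 0\<close>, and \<open>|g| < M\<close> near \<open>0\<close>. As \<open>J\<^sup>\<alpha>\<close> has a positive kernel and maps the
  constant \<open>M\<close> to \<open>M x\<^sup>\<alpha> / \<Gamma>(\<alpha>+1)\<close>, it follows that \<open>\<Gamma>(\<alpha>+1) |J\<^sup>\<alpha> g c| < M c\<^sup>\<alpha>\<close>, a contradiction. So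
  \<open>g = 0\<close> and \<open>w = J\<^sup>\<alpha> 0 = 0\<close>. The constant \<open>\<Gamma>(\<alpha>+1)\<close> is the one for which the two bounds just meet;
  the strict inequality comes only from \<open>g 0 = 0\<close>.
\<close>

section \<open>The Riemann-Liouville kernels\<close>

text \<open>
  With a kernel that vanishes on the negative half-line, fractional integration becomes a
  convolution on the whole real line, and the limits of integration disappear from Fubini's theorem.
\<close>

definition rl_kernel :: "real \<Rightarrow> real \<Rightarrow> real" where
  "rl_kernel a t = (if 0 < t then t powr (a - 1) / Gamma a else 0)"

lemma rl_kernel_measurable [measurable]: "rl_kernel a \<in> borel_measurable borel"
  unfolding rl_kernel_def[abs_def] by measurable

lemma rl_kernel_nonneg: "0 < a \<Longrightarrow> 0 \<le> rl_kernel a t"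
  by (simp add: rl_kernel_def less_imp_le)

lemma rl_kernel_nonpos_arg [simp]: "t \<le> 0 \<Longrightarrow> rl_kernel a t = 0"
  by (simp add: rl_kernel_def)

lemma rl_kernel_one: "rl_kernel 1 t = (if 0 < t then 1 else 0)"
  by (simp add: rl_kernel_def)

text \<open>
  The kernels form a convolution semigroup: the substitution \<open>t = s + (x - s) v\<close> reduces the
  convolution to Euler's Beta integral. The case \<open>c = 1\<close>, \<open>s = 0\<close> also gives the integral of the
  kernel over \<open>[0,x]\<close>, that is, the fractional integral of the constant \<open>1\<close>.
\<close>

lemma nn_integral_rl_kernel_convolution:
  assumes a: "0 < a" and c: "0 < c"
  shows "(\<integral>\<^sup>+t. ennreal (rl_kernel a (x - t) * rl_kernel c (t - s)) \<partial>lborel)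
         = ennreal (rl_kernel (a + c) (x - s))"
proof (cases "s < x")
  case False
  then have "rl_kernel a (x - t) * rl_kernel c (t - s) = 0" for t
    by (simp add: rl_kernel_def)
  moreover have "rl_kernel (a + c) (x - s) = 0"
    using False by simp
  ultimately show ?thesis
    by (simp only: ennreal_0 nn_integral_const) simp
next
  case True
  define L where "L = x - s"
  define C where "C = L powr (a + c - 2) / (Gamma a * Gamma c)"
  define k where "k v = (v powr (c - 1) * (1 - v) powr (a - 1)) * indicator {0..1} v" for v :: real
  have L: "0 < L"
    using True by (simp add: L_def)
  have C: "0 \<le> C"
    using a c by (simp add: C_def less_imp_le)
  have Gam: "0 < Gamma a" "0 < Gamma c" "0 < Gamma (a + c)"
    using a c by simp_all
  have k_nonneg: "0 \<le> k v" for v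
    by (simp add: k_def)
  have k_meas [measurable]: "k \<in> borel_measurable borel"
    unfolding k_def[abs_def] by measurable
  have "(k has_integral Beta c a) UNIV"
    using has_integral_Beta_real[OF c a]
    unfolding k_def has_integral_restrict_UNIV[of "{0..1::real}", symmetric]
    by (rule back_subst[where P="\<lambda>g. (g has_integral Beta c a) UNIV"])
       (auto simp: indicator_def fun_eq_iff)
  then have k_int: "(\<integral>\<^sup>+v. ennreal (k v) \<partial>lborel) = ennreal (Beta c a)"
    by (intro nn_integral_has_integral_lborel k_meas k_nonneg)
  have scaled: "rl_kernel a (x - (s + L * v)) * rl_kernel c (L * v) = C * k v" for v
  proof (cases "0 < v \<and> v < 1")
    case True
    have xv: "x - (s + L * v) = L * (1 - v)"
      by (simp add: L_def algebra_simps)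
    have "L powr (a - 1) * L powr (c - 1) = L powr (a + c - 2)"
      by (simp add: powr_add[symmetric])
    then show ?thesis
      using True L Gam
      by (simp add: xv rl_kernel_def C_def k_def powr_mult zero_less_mult_iff)
  next
    case False
    then have "v \<le> 0 \<or> v \<ge> 1" by auto
    then show ?thesis
    proof
      assume "v \<le> 0"
      then show ?thesis using L
        by (cases "v = 0") (simp_all add: rl_kernel_def k_def zero_less_mult_iff)
    next
      assume "1 \<le> v"
      then have "L * 1 \<le> L * v" using L by (intro mult_left_mono) auto
      then have "x - (s + L * v) \<le> 0" by (simp add: L_def)
      then show ?thesis using \<open>1 \<le> v\<close>
        by (cases "v = 1") (simp_all add: k_def)
    qed
  qed
  have "(\<integral>\<^sup>+t. ennreal (rl_kernel a (x - t) * rl_kernel c (t - s)) \<partial>lborel)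
        = ennreal L * (\<integral>\<^sup>+v. ennreal (C * k v) \<partial>lborel)"
    using L by (subst nn_integral_real_affine[where c = L and t = s]) (simp_all add: scaled)
  also have "\<dots> = ennreal (L * (C * Beta c a))"
    using L C by (simp add: ennreal_mult' nn_integral_cmult k_int k_nonneg)
  also have "L * (C * Beta c a) = rl_kernel (a + c) L"
  proof -
    have "L * L powr (a + c - 2) = L powr (a + c - 1)"
      using L powr_add[of L 1 "a + c - 2"] by simp
    then show ?thesis
      using L Gam by (simp add: C_def rl_kernel_def Beta_def add.commute)
  qed
  finally show ?thesis
    by (simp add: L_def)
qed

lemma has_bochner_integral_rl_kernel_convolution:
  assumes "0 < a" "0 < c"
  shows "has_bochner_integral lborel (\<lambda>t. rl_kernel a (x - t) * rl_kernel c (t - s))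
           (rl_kernel (a + c) (x - s))"
  using assms
  by (intro has_bochner_integral_nn_integral nn_integral_rl_kernel_convolution)
     (auto simp: rl_kernel_nonneg)

section \<open>Fractional integrals of bounded causal functions\<close>

text \<open>
  For such functions every fractional integral converges absolutely at every point, since only
  the values on \<open>[0,x]\<close> enter.
\<close>

definition causal_bounded :: "(real \<Rightarrow> real) \<Rightarrow> bool" where
  "causal_bounded h \<longleftrightarrow>
     h \<in> borel_measurable borel \<and> (\<exists>B. \<forall>t. \<bar>h t\<bar> \<le> B) \<and> (\<forall>t\<le>0. h t = 0)"

definition frac_int :: "real \<Rightarrow> (real \<Rightarrow> real) \<Rightarrow> real \<Rightarrow> real" where
  "frac_int a h x = (\<integral>t. rl_kernel a (x - t) * h t \<partial>lborel)"

text \<open>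
  The multiple of \<open>rl_kernel 1\<close>, the unit step, is a majorant whose fractional integrals are known.
\<close>

lemma causal_boundedD:
  assumes "causal_bounded h"
  obtains B where "h \<in> borel_measurable borel" "0 \<le> B" "\<And>t. \<bar>h t\<bar> \<le> B * rl_kernel 1 t"
proof -
  obtain B where B: "\<And>t. \<bar>h t\<bar> \<le> B"
    using assms by (auto simp: causal_bounded_def)
  have "0 \<le> B" using B[of 0] by linarith
  show thesis
  proof
    show "\<bar>h t\<bar> \<le> B * rl_kernel 1 t" for t
      using B[of t] assms by (auto simp: causal_bounded_def rl_kernel_one)
  qed (use assms \<open>0 \<le> B\<close> in \<open>auto simp: causal_bounded_def\<close>)
qed

lemma frac_int_integrable:
  assumes a: "0 < a" and h: "causal_bounded h"
  shows "integrable lborel (\<lambda>t. rl_kernel a (x - t) * h t)"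
proof -
  obtain B where [measurable]: "h \<in> borel_measurable borel"
    and "0 \<le> B" and B: "\<And>t. \<bar>h t\<bar> \<le> B * rl_kernel 1 t"
    using causal_boundedD[OF h] by blast
  show ?thesis
  proof (rule Bochner_Integration.integrable_bound)
    show "integrable lborel (\<lambda>t. B * (rl_kernel a (x - t) * rl_kernel 1 t))"
      using has_bochner_integral_rl_kernel_convolution[OF a, of 1 x 0]
      by (auto dest: integrable.intros)
    show "AE t in lborel. norm (rl_kernel a (x - t) * h t)
            \<le> norm (B * (rl_kernel a (x - t) * rl_kernel 1 t))"
    proof (rule AE_I2)
      fix t
      have "rl_kernel a (x - t) * \<bar>h t\<bar> \<le> rl_kernel a (x - t) * (B * rl_kernel 1 t)"
        by (intro mult_left_mono B rl_kernel_nonneg a)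
      then show "norm (rl_kernel a (x - t) * h t)
          \<le> norm (B * (rl_kernel a (x - t) * rl_kernel 1 t))"
        using \<open>0 \<le> B\<close> by (simp add: abs_mult rl_kernel_nonneg a mult_ac)
    qed
  qed measurable
qed

lemma frac_int_cong:
  assumes "\<And>t. t < x \<Longrightarrow> g t = h t"
  shows "frac_int a g x = frac_int a h x"
  unfolding frac_int_def
  by (rule Bochner_Integration.integral_cong) (auto simp: rl_kernel_def assms)

lemma frac_int_diff:
  assumes "0 < a" "causal_bounded g" "causal_bounded h"
  shows "frac_int a (\<lambda>t. g t - h t) x = frac_int a g x - frac_int a h x"
  unfolding frac_int_def right_diff_distrib
  by (intro Bochner_Integration.integral_diff frac_int_integrable assms)

lemma frac_int_nonpos:
  assumes "causal_bounded h" "x \<le> 0"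
  shows "frac_int a h x = 0"
proof -
  have "rl_kernel a (x - t) * h t = 0" for t
    using assms by (cases "t \<le> 0") (auto simp: causal_bounded_def)
  then show ?thesis by (simp only: frac_int_def) simp
qed

text \<open>
  Fubini's theorem moves the convolution onto the kernels. It applies because, by
  Tonelli's theorem, the same computation with \<open>|h|\<close> in place of \<open>h\<close> has a finite result.
\<close>

lemma frac_int_semigroup:
  assumes a: "0 < a" and c: "0 < c" and h: "causal_bounded h"
  shows "frac_int a (frac_int c h) x = frac_int (a + c) h x"
proof -
  obtain B where [measurable]: "h \<in> borel_measurable borel"
    and "0 \<le> B" and B: "\<And>t. \<bar>h t\<bar> \<le> B * rl_kernel 1 t"
    using causal_boundedD[OF h] by blast
  define F where "F t s = rl_kernel a (x - t) * rl_kernel c (t - s) * h s" for t s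
  have F_meas: "case_prod F \<in> borel_measurable (lborel \<Otimes>\<^sub>M lborel)"
    unfolding F_def by measurable
  have norm_F: "norm (F t s) = \<bar>h s\<bar> * (rl_kernel a (x - t) * rl_kernel c (t - s))" for t s
    by (simp add: F_def abs_mult rl_kernel_nonneg a c mult_ac)
  have inner: "(\<integral>\<^sup>+t. ennreal (norm (F t s)) \<partial>lborel) = ennreal (\<bar>h s\<bar> * rl_kernel (a + c) (x - s))"
    for s
    unfolding norm_F
    by (subst ennreal_mult')
       (simp_all add: nn_integral_cmult nn_integral_rl_kernel_convolution a c ennreal_mult')
  have "(\<integral>\<^sup>+p. ennreal (norm (case_prod F p)) \<partial>(lborel \<Otimes>\<^sub>M lborel))
        = (\<integral>\<^sup>+s. (\<integral>\<^sup>+t. ennreal (norm (F t s)) \<partial>lborel) \<partial>lborel)"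
    using F_meas by (subst lborel_pair.nn_integral_snd[symmetric]) auto
  also have "\<dots> = (\<integral>\<^sup>+s. ennreal (norm (rl_kernel (a + c) (x - s) * h s)) \<partial>lborel)"
    unfolding inner using a c by (simp add: abs_mult rl_kernel_nonneg mult_ac)
  also have "\<dots> < \<infinity>"
    using frac_int_integrable[OF _ h, of "a + c" x] a c by (simp add: integrable_iff_bounded)
  finally have F_int: "integrable (lborel \<Otimes>\<^sub>M lborel) (case_prod F)"
    using F_meas by (simp add: integrable_iff_bounded)
  have "frac_int a (frac_int c h) x = (\<integral>t. (\<integral>s. F t s \<partial>lborel) \<partial>lborel)"
    by (simp add: frac_int_def F_def mult.assoc)
  also have "\<dots> = (\<integral>s. (\<integral>t. F t s \<partial>lborel) \<partial>lborel)"
    by (rule lborel_pair.Fubini_integral[OF F_int, symmetric])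
  also have "(\<lambda>s. \<integral>t. F t s \<partial>lborel) = (\<lambda>s. rl_kernel (a + c) (x - s) * h s)"
    unfolding F_def
    using has_bochner_integral_integral_eq[OF has_bochner_integral_rl_kernel_convolution[OF a c]]
    by simp
  finally show ?thesis
    by (simp add: frac_int_def)
qed

text \<open>
  After the reflection \<open>u = x - t\<close> the singular kernel no longer depends on \<open>x\<close>, so dominated
  convergence applies. For all \<open>x \<le> A\<close> the integrand vanishes when \<open>u \<ge> A\<close>, by causality, which
  gives an integrable majorant.
\<close>

lemma frac_int_continuous:
  assumes a: "0 < a" and h: "causal_bounded h" and cont: "continuous_on UNIV h"
  shows "continuous_on UNIV (frac_int a h)"
proof -
  obtain B where [measurable]: "h \<in> borel_measurable borel"
    and "0 \<le> B" and B: "\<And>t. \<bar>h t\<bar> \<le> B * rl_kernel 1 t"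
    using causal_boundedD[OF h] by blast
  have flip: "frac_int a h x = (\<integral>u. rl_kernel a u * h (x - u) \<partial>lborel)" for x
    unfolding frac_int_def
    by (subst lborel_integral_real_affine[where c = "-1" and t = x]) simp_all
  show ?thesis
  proof (rule continuous_at_imp_continuous_on, rule ballI, rule continuous_at_sequentiallyI)
    fix x :: real and X assume X: "X \<longlonglongrightarrow> x"
    then obtain A where A: "\<And>n. norm (X n) \<le> A"
      by (meson Bseq_def convergentI convergent_imp_Bseq)
    have "(\<lambda>n. \<integral>u. rl_kernel a u * h (X n - u) \<partial>lborel)
            \<longlonglongrightarrow> (\<integral>u. rl_kernel a u * h (x - u) \<partial>lborel)"
    proof (rule integral_dominated_convergence)
      show "integrable lborel (\<lambda>u. B * (rl_kernel 1 (A - u) * rl_kernel a (u - 0)))"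
        using has_bochner_integral_rl_kernel_convolution[OF _ a, of 1 A 0]
        by (intro integrable_mult_right) (auto dest: integrable.intros)
      show "AE u in lborel. (\<lambda>n. rl_kernel a u * h (X n - u)) \<longlonglongrightarrow> rl_kernel a u * h (x - u)"
      proof (rule AE_I2)
        fix u
        have "isCont h (x - u)"
          using cont by (simp add: continuous_on_eq_continuous_at)
        then have "(\<lambda>n. h (X n - u)) \<longlonglongrightarrow> h (x - u)"
          by (rule isCont_tendsto_compose) (intro tendsto_intros X)
        then show "(\<lambda>n. rl_kernel a u * h (X n - u)) \<longlonglongrightarrow> rl_kernel a u * h (x - u)"
          by (intro tendsto_intros)
      qed
      show "AE u in lborel. norm (rl_kernel a u * h (X n - u))
              \<le> B * (rl_kernel 1 (A - u) * rl_kernel a (u - 0))" for n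
      proof (rule AE_I2)
        fix u
        have "rl_kernel 1 (X n - u) \<le> rl_kernel 1 (A - u)"
          using A[of n] by (auto simp: rl_kernel_one)
        then have "\<bar>h (X n - u)\<bar> \<le> B * rl_kernel 1 (A - u)"
          using B[of "X n - u"] \<open>0 \<le> B\<close> by (meson mult_left_mono order_trans)
        then have "rl_kernel a u * \<bar>h (X n - u)\<bar> \<le> rl_kernel a u * (B * rl_kernel 1 (A - u))"
          by (intro mult_left_mono rl_kernel_nonneg a)
        then show "norm (rl_kernel a u * h (X n - u))
              \<le> B * (rl_kernel 1 (A - u) * rl_kernel a (u - 0))"
          by (simp add: abs_mult rl_kernel_nonneg a mult_ac)
      qed
    qed measurable
    then show "(\<lambda>n. frac_int a h (X n)) \<longlonglongrightarrow> frac_int a h x"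
      by (simp add: flip)
  qed
qed

lemma RL_integral_eq_frac_int:
  assumes a: "0 < a" and h: "causal_bounded h" and gh: "\<And>t. t \<in> {0..x} \<Longrightarrow> g t = h t"
  shows "RL_integral a g x = frac_int a h x"
proof -
  have "integral {0..x} (\<lambda>t. (x - t) powr (a - 1) * g t)
        = integral {0..x} (\<lambda>t. Gamma a * (rl_kernel a (x - t) * h t))"
    using a gh by (intro integral_cong)
      (auto simp: rl_kernel_def Gamma_real_pos less_imp_neq[symmetric])
  also have "\<dots> = Gamma a * integral {0..x} (\<lambda>t. rl_kernel a (x - t) * h t)"
    by simp
  also have "integral {0..x} (\<lambda>t. rl_kernel a (x - t) * h t)
             = (LINT t:{0..x}|lborel. rl_kernel a (x - t) * h t)"
    using frac_int_integrable[OF a h, of x]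
    by (intro set_borel_integral_eq_integral(2)[symmetric])
       (simp add: set_integrable_def integrable_mult_indicator del: real_scaleR_def)
  also have "\<dots> = frac_int a h x"
    unfolding set_lebesgue_integral_def frac_int_def
  proof (rule Bochner_Integration.integral_cong)
    fix t
    show "indicator {0..x} t *\<^sub>R (rl_kernel a (x - t) * h t) = rl_kernel a (x - t) * h t"
      using h by (cases "t \<le> 0"; cases "x \<le> t") (auto simp: causal_bounded_def)
  qed simp
  finally show ?thesis
    using Gamma_real_pos[OF a] by (simp add: RL_integral_def)
qed

text \<open>
  The two integrands may differ at \<open>t = x\<close>, where \<open>0 powr 0 = 0\<close>.
\<close>

lemma frac_int_one:
  assumes h: "causal_bounded h" and gh: "\<And>t. t \<in> {0..x} \<Longrightarrow> g t = h t"
  shows "frac_int 1 h x = integral {0..x} g"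
proof -
  have "frac_int 1 h x = integral {0..x} (\<lambda>t. (x - t) powr (1 - 1) * g t)"
    using RL_integral_eq_frac_int[OF _ h gh, of 1] by (simp add: RL_integral_def)
  also have "\<dots> = integral {0..x} g"
    by (rule integral_spike[of "{x}"]) auto
  finally show ?thesis .
qed

lemma frac_int_one_deriv:
  assumes h: "causal_bounded h" and cont: "continuous_on UNIV h" and x: "x \<in> {0..b}"
  shows "(frac_int 1 h has_real_derivative h x) (at x within {0..b})"
proof -
  have "((\<lambda>x. integral {0..x} h) has_real_derivative h x) (at x within {0..b})"
    using continuous_on_subset[OF cont] x by (intro integral_has_real_derivative) auto
  moreover have "frac_int 1 h = (\<lambda>x. integral {0..x} h)"
    using frac_int_one[OF h, where g = h] by (simp add: fun_eq_iff)
  ultimately show ?thesis by simp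
qed

text \<open>
  A function on \<open>[0,b]\<close> is shifted to vanish at \<open>0\<close> and extended by its boundary values, so that the
  extension stays continuous on the whole real line. The shift is the one in the Caputo derivative.
\<close>

definition causal_ext :: "real \<Rightarrow> (real \<Rightarrow> real) \<Rightarrow> real \<Rightarrow> real" where
  "causal_ext b u t = u (max 0 (min b t)) - u 0"

lemma causal_ext_eq: "t \<in> {0..b} \<Longrightarrow> causal_ext b u t = u t - u 0"
  by (simp add: causal_ext_def)

lemma causal_ext_continuous:
  assumes "0 < b" "continuous_on {0..b} u"
  shows "continuous_on UNIV (causal_ext b u)"
  unfolding causal_ext_def[abs_def] using assms
  by (intro continuous_intros continuous_on_compose2[OF assms(2)]) auto

lemma causal_ext_bounded:
  assumes "0 < b" "continuous_on {0..b} u"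
  shows "causal_bounded (causal_ext b u)"
  unfolding causal_bounded_def
proof (intro conjI)
  show "causal_ext b u \<in> borel_measurable borel"
    by (intro borel_measurable_continuous_onI causal_ext_continuous assms)
  show "\<forall>t\<le>0. causal_ext b u t = 0"
    using assms by (simp add: causal_ext_def)
  have "compact (u ` {0..b})"
    by (intro compact_continuous_image assms) auto
  then obtain B where B: "\<And>t. t \<in> {0..b} \<Longrightarrow> \<bar>u t\<bar> \<le> B"
    by (force dest!: compact_imp_bounded simp: bounded_iff)
  have "\<bar>causal_ext b u t\<bar> \<le> B + B" for t
    using B[of "max 0 (min b t)"] B[of 0] assms by (auto simp: causal_ext_def)
  then show "\<exists>B. \<forall>t. \<bar>causal_ext b u t\<bar> \<le> B" by blast
qed

section \<open>Inversion\<close>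

lemma real_derivative_unique_within_Icc:
  fixes b :: real
  assumes "0 < b" "x \<in> {0..b}"
    and "(F has_real_derivative d) (at x within {0..b})"
    and "(F has_real_derivative e) (at x within {0..b})"
  shows "d = e"
proof -
  have "at x within {0..b} \<noteq> bot"
    using assms by (auto simp: trivial_limit_within islimpt_Icc)
  then show ?thesis
    using assms(3,4) unfolding has_field_derivative_iff by (rule tendsto_unique)
qed

text \<open>
  This is Abel's inversion: the fractional integral of order \<open>1 - \<alpha>\<close> is completed to an
  ordinary integral on both sides, and the ordinary integrals are then differentiated. The last
  step yields equality at every point because \<open>frac_int \<alpha> g\<close> is continuous.
\<close>

lemma frac_int_inversion:
  assumes \<alpha>: "0 < \<alpha>" "\<alpha> < 1" and b: "0 < b"
    and w: "causal_bounded w" "continuous_on UNIV w"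
    and g: "causal_bounded g" "continuous_on UNIV g"
    and deriv: "\<And>x. x \<in> {0..b} \<Longrightarrow>
          (frac_int (1 - \<alpha>) w has_real_derivative g x) (at x within {0..b})"
    and x: "x \<in> {0..b}"
  shows "w x = frac_int \<alpha> g x"
proof -
  have antider: "frac_int (1 - \<alpha>) w t = frac_int 1 g t" if "t \<le> b" for t
  proof (cases "t \<le> 0")
    case True
    then show ?thesis using w g by (simp add: frac_int_nonpos)
  next
    case False
    have "(g has_integral frac_int (1 - \<alpha>) w t - frac_int (1 - \<alpha>) w 0) {0..t}"
    proof (rule fundamental_theorem_of_calculus)
      show "(frac_int (1 - \<alpha>) w has_vector_derivative g x) (at x within {0..t})"
        if "x \<in> {0..t}" for x
        using deriv[of x] that \<open>t \<le> b\<close>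
        unfolding has_real_derivative_iff_has_vector_derivative
        by (auto intro: has_vector_derivative_within_subset)
    qed (use False in auto)
    then show ?thesis
      using frac_int_one[OF g(1), where g = g and x = t] w(1)
      by (simp add: frac_int_nonpos integral_unique)
  qed
  have v: "continuous_on UNIV (frac_int \<alpha> g)"
    by (rule frac_int_continuous) fact+
  have same: "frac_int 1 w x = integral {0..x} (frac_int \<alpha> g)" if "x \<le> b" for x
  proof -
    have "frac_int 1 w x = frac_int \<alpha> (frac_int (1 - \<alpha>) w) x"
      using \<alpha> by (simp add: frac_int_semigroup w)
    also have "\<dots> = frac_int \<alpha> (frac_int 1 g) x"
      using that by (intro frac_int_cong antider) auto
    also have "\<dots> = frac_int 1 (frac_int \<alpha> g) x"
      using \<alpha> by (simp add: frac_int_semigroup g add.commute)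
    \<comment> \<open>\<open>frac_int \<alpha> g\<close> may be unbounded beyond \<open>b\<close>; cutting it off there does not affect the
      values of its integral on \<open>[0,b]\<close>.\<close>
    also have "\<dots> = frac_int 1 (causal_ext b (frac_int \<alpha> g)) x"
      using that b g(1) by (intro frac_int_cong) (simp add: causal_ext_def frac_int_nonpos max_def)
    also have "\<dots> = integral {0..x} (frac_int \<alpha> g)"
      using that b g(1)
      by (intro frac_int_one causal_ext_bounded continuous_on_subset[OF v])
         (auto simp: causal_ext_eq frac_int_nonpos)
    finally show ?thesis .
  qed
  have "((\<lambda>x. integral {0..x} (frac_int \<alpha> g)) has_real_derivative frac_int \<alpha> g x)
          (at x within {0..b})"
    using continuous_on_subset[OF v] x by (intro integral_has_real_derivative) auto
  then have "(frac_int 1 w has_real_derivative frac_int \<alpha> g x) (at x within {0..b})"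
    by (rule has_field_derivative_transform_within[OF _ zero_less_one x]) (simp add: same)
  with frac_int_one_deriv[OF w x] show ?thesis
    by (rule real_derivative_unique_within_Icc[OF b x])
qed

section \<open>The extremal argument\<close>

text \<open>
  At a point \<open>c\<close> where \<open>|g|\<close> attains its maximum \<open>M\<close>, the quantity \<open>\<Gamma>(\<alpha>+1) J\<^sup>\<alpha> |g|\<close> is
  strictly smaller than its value \<open>M c\<^sup>\<alpha>\<close> for the constant \<open>M\<close>, because \<open>g\<close> is small near \<open>0\<close>.
\<close>

lemma frac_int_extremal:
  assumes \<alpha>: "0 < \<alpha>" and b: "0 < b"
    and g: "causal_bounded g" "continuous_on UNIV g"
    and ineq: "\<And>x. x \<in> {0..b} \<Longrightarrow> x powr \<alpha> * \<bar>g x\<bar> \<le> Gamma (\<alpha> + 1) * \<bar>frac_int \<alpha> g x\<bar>"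
    and x: "x \<in> {0..b}"
  shows "g x = 0"
proof (rule ccontr)
  assume "g x \<noteq> 0"
  have "continuous_on {0..b} (\<lambda>t. \<bar>g t\<bar>)"
    by (intro continuous_intros continuous_on_subset[OF g(2)]) auto
  then obtain c where c: "c \<in> {0..b}" and max: "\<And>t. t \<in> {0..b} \<Longrightarrow> \<bar>g t\<bar> \<le> \<bar>g c\<bar>"
    using continuous_attains_sup[of "{0..b}" "\<lambda>t. \<bar>g t\<bar>"] b by auto
  define M where "M = \<bar>g c\<bar>"
  have M: "0 < M"
    using max[OF x] \<open>g x \<noteq> 0\<close> by (simp add: M_def)
  have g0: "g 0 = 0" and g_neg: "\<And>t. t \<le> 0 \<Longrightarrow> g t = 0"
    using g(1) by (auto simp: causal_bounded_def)
  have c0: "0 < c"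
    using c M g0 by (cases "c = 0") (auto simp: M_def)
  have Gam: "0 < Gamma (\<alpha> + 1)"
    using \<alpha> by simp
  note [measurable] = borel_measurable_continuous_onI[OF g(2)]
  have abs_g: "causal_bounded (\<lambda>t. \<bar>g t\<bar>)"
    using g(1) by (auto simp: causal_bounded_def)
  \<comment> \<open>The integral of \<open>d\<close> is what is lost when the constant \<open>M\<close> is replaced by \<open>|g|\<close>.\<close>
  define d where "d t = rl_kernel \<alpha> (c - t) * (M * rl_kernel 1 t - \<bar>g t\<bar>)" for t
  have const_int: "has_bochner_integral lborel
      (\<lambda>t. M * (rl_kernel \<alpha> (c - t) * rl_kernel 1 (t - 0))) (M * rl_kernel (\<alpha> + 1) (c - 0))"
    by (intro has_bochner_integral_mult_right has_bochner_integral_rl_kernel_convolution \<alpha>) simp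
  have abs_int: "has_bochner_integral lborel (\<lambda>t. rl_kernel \<alpha> (c - t) * \<bar>g t\<bar>)
      (frac_int \<alpha> (\<lambda>t. \<bar>g t\<bar>) c)"
    unfolding frac_int_def
    by (intro has_bochner_integral_integrable frac_int_integrable abs_g \<alpha>)
  have d_int: "has_bochner_integral lborel d
      (M * rl_kernel (\<alpha> + 1) c - frac_int \<alpha> (\<lambda>t. \<bar>g t\<bar>) c)"
    using has_bochner_integral_diff[OF const_int abs_int]
    by (simp add: d_def[abs_def] algebra_simps)
  have d_nonneg: "0 \<le> d t" for t
  proof (cases "0 < t \<and> t < c")
    case True
    then show ?thesis
      using max[of t] c \<alpha> by (simp add: d_def M_def rl_kernel_one rl_kernel_nonneg)
  next
    case False
    then show ?thesis
      using g_neg[of t] by (cases "t \<le> 0") (auto simp: d_def)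
  qed
  have d_pos_int: "0 < M * rl_kernel (\<alpha> + 1) c - frac_int \<alpha> (\<lambda>t. \<bar>g t\<bar>) c"
  proof -
    have "isCont (\<lambda>t. \<bar>g t\<bar>) 0"
      using g(2) by (intro continuous_intros) (simp add: continuous_on_eq_continuous_at)
    then obtain \<delta> where "0 < \<delta>" and \<delta>: "\<And>t. \<bar>t\<bar> < \<delta> \<Longrightarrow> \<bar>g t\<bar> < M"
      using M unfolding continuous_at_eps_delta
      by (force simp: g0 dist_real_def)
    define r where "r = min \<delta> c"
    have r: "0 < r"
      using \<open>0 < \<delta>\<close> c0 by (simp add: r_def)
    have d_pos: "d t \<noteq> 0" if "t \<in> {0<..<r}" for t
      using that \<delta>[of t] Gamma_real_pos[OF \<alpha>] by (auto simp: d_def r_def rl_kernel_def)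
    have "\<not> (AE t in lborel. d t = 0)"
    proof
      assume "AE t in lborel. d t = 0"
      then have "AE t in lborel. t \<notin> {0<..<r}"
        by eventually_elim (use d_pos in auto)
      then have "emeasure lborel {0<..<r} = 0"
        by (subst (asm) AE_iff_measurable[where N = "{0<..<r}"]) auto
      then show False using r by simp
    qed
    then have "integral\<^sup>L lborel d \<noteq> 0"
      using d_int d_nonneg by (subst integral_nonneg_eq_0_iff_AE) (auto intro: integrable.intros)
    moreover have "0 \<le> integral\<^sup>L lborel d"
      using d_nonneg by simp
    ultimately show ?thesis
      using has_bochner_integral_integral_eq[OF d_int] by linarith
  qed
  have "c powr \<alpha> * M \<le> Gamma (\<alpha> + 1) * \<bar>frac_int \<alpha> g c\<bar>"
    using ineq[OF c] by (simp add: M_def)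
  also have "\<bar>frac_int \<alpha> g c\<bar> \<le> frac_int \<alpha> (\<lambda>t. \<bar>g t\<bar>) c"
    using integral_abs_bound[of lborel "\<lambda>t. rl_kernel \<alpha> (c - t) * g t"]
    by (simp add: frac_int_def abs_mult rl_kernel_nonneg \<alpha>)
  also have "\<dots> < M * rl_kernel (\<alpha> + 1) c"
    using d_pos_int by simp
  also have "Gamma (\<alpha> + 1) * (M * rl_kernel (\<alpha> + 1) c) = c powr \<alpha> * M"
    using c0 Gam by (simp add: rl_kernel_def)
  finally show False
    using Gam by simp
qed

section \<open>Uniqueness\<close>

lemma caputo_deriv_eq:
  assumes "0 < b" "x \<in> {0..b}" "has_caputo_deriv \<alpha> b y d x"
  shows "caputo_deriv \<alpha> b y x = d"
  unfolding caputo_deriv_def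
  using assms real_derivative_unique_within_Icc[OF assms(1,2)]
  by (intro the_equality) (auto simp: has_caputo_deriv_def)

text \<open>
  The calculus of \<open>frac_int\<close> becomes applicable to solutions on \<open>[0,b]\<close>: the one-sided derivative
  only sees values at points of \<open>[0,b]\<close>, where the two integral operators agree.
\<close>

lemma has_caputo_deriv_frac_int:
  assumes "\<alpha> < 1" "0 < b" "continuous_on {0..b} y" "x \<in> {0..b}" "has_caputo_deriv \<alpha> b y d x"
  shows "(frac_int (1 - \<alpha>) (causal_ext b y) has_real_derivative d) (at x within {0..b})"
proof (rule has_field_derivative_transform_within[OF _ zero_less_one])
  show "(RL_integral (1 - \<alpha>) (\<lambda>t. y t - y 0) has_real_derivative d) (at x within {0..b})"
    using assms by (simp add: has_caputo_deriv_def)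
  show "RL_integral (1 - \<alpha>) (\<lambda>t. y t - y 0) t = frac_int (1 - \<alpha>) (causal_ext b y) t"
    if "t \<in> {0..b}" for t
    using assms that
    by (intro RL_integral_eq_frac_int causal_ext_bounded) (auto simp: causal_ext_eq)
qed (use assms in auto)

theorem theorem3p1:
  fixes \<alpha> b y0 :: real and f :: "real \<Rightarrow> real \<Rightarrow> real"
  assumes "0 < \<alpha>" and "\<alpha> < 1" and "0 < b"
    and "continuous (at (0, y0) within {0..b} \<times> UNIV) (\<lambda>(x, y). f x y)"
    and "\<And>x y1 y2. x \<in> {0..b} \<Longrightarrow>
           x powr \<alpha> * \<bar>f x y1 - f x y2\<bar> \<le> Gamma (\<alpha> + 1) * \<bar>y1 - y2\<bar>"
  shows "\<forall>y z.
           caputo_ivp_solution \<alpha> b f y0 y \<and> continuous_on {0..b} y \<and>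
             continuous_on {0..b} (caputo_deriv \<alpha> b y) \<and>
           caputo_ivp_solution \<alpha> b f y0 z \<and> continuous_on {0..b} z \<and>
             continuous_on {0..b} (caputo_deriv \<alpha> b z) \<longrightarrow>
           (\<forall>x\<in>{0..b}. y x = z x)"
proof (intro allI impI ballI, elim conjE)
  note \<alpha> = \<open>0 < \<alpha>\<close> \<open>\<alpha> < 1\<close> and b = \<open>0 < b\<close>
  fix y z x
  assume y: "caputo_ivp_solution \<alpha> b f y0 y" "continuous_on {0..b} y"
      "continuous_on {0..b} (caputo_deriv \<alpha> b y)"
    and z: "caputo_ivp_solution \<alpha> b f y0 z" "continuous_on {0..b} z"
      "continuous_on {0..b} (caputo_deriv \<alpha> b z)"
    and x: "x \<in> {0..b}"
  have y0: "y 0 = y0" and z0: "z 0 = y0"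
    and yd: "\<And>t. t \<in> {0..b} \<Longrightarrow> has_caputo_deriv \<alpha> b y (f t (y t)) t"
    and zd: "\<And>t. t \<in> {0..b} \<Longrightarrow> has_caputo_deriv \<alpha> b z (f t (z t)) t"
    using y(1) z(1) by (auto simp: caputo_ivp_solution_def)
  \<comment> \<open>Writing \<open>u\<close> with the Caputo derivatives makes its continuity part of the assumptions on the
    two solutions.\<close>
  define w where "w = (\<lambda>t. causal_ext b y t - causal_ext b z t)"
  define u where "u t = caputo_deriv \<alpha> b y t - caputo_deriv \<alpha> b z t" for t
  define g where "g = causal_ext b u"
  have u_eq: "u t = f t (y t) - f t (z t)" if "t \<in> {0..b}" for t
    using caputo_deriv_eq[OF b that] yd[OF that] zd[OF that] by (simp add: u_def)
  have u_cont: "continuous_on {0..b} u"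
    unfolding u_def by (intro continuous_intros y z)
  have g: "causal_bounded g" "continuous_on UNIV g"
    unfolding g_def by (intro causal_ext_bounded causal_ext_continuous b u_cont)+
  have g_eq: "g t = f t (y t) - f t (z t)" if "t \<in> {0..b}" for t
    using that u_eq[OF that] u_eq[of 0] b by (simp add: g_def causal_ext_eq y0 z0)
  have w_eq: "w t = y t - z t" if "t \<in> {0..b}" for t
    using that by (simp add: w_def causal_ext_eq y0 z0)
  have ext_bounded: "causal_bounded (causal_ext b y)" "causal_bounded (causal_ext b z)"
    using b y z by (simp_all add: causal_ext_bounded)
  have w_ext: "w = causal_ext b (\<lambda>t. y t - z t)"
    by (simp add: w_def causal_ext_def fun_eq_iff)
  have w: "causal_bounded w" "continuous_on UNIV w"
    unfolding w_ext
    by (intro causal_ext_bounded causal_ext_continuous continuous_intros b y z)+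
  have w_frac: "w t = frac_int \<alpha> g t" if "t \<in> {0..b}" for t
  proof (rule frac_int_inversion[OF \<alpha> b w g _ that])
    fix t assume t: "t \<in> {0..b}"
    have "((\<lambda>s. frac_int (1 - \<alpha>) (causal_ext b y) s - frac_int (1 - \<alpha>) (causal_ext b z) s)
            has_real_derivative f t (y t) - f t (z t)) (at t within {0..b})"
      by (intro derivative_intros has_caputo_deriv_frac_int \<alpha> b y z t yd zd)
    moreover have "frac_int (1 - \<alpha>) w
        = (\<lambda>s. frac_int (1 - \<alpha>) (causal_ext b y) s - frac_int (1 - \<alpha>) (causal_ext b z) s)"
      unfolding w_def using \<alpha> by (intro ext) (simp add: frac_int_diff ext_bounded)
    ultimately show "(frac_int (1 - \<alpha>) w has_real_derivative g t) (at t within {0..b})"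
      using g_eq[OF t] by simp
  qed
  have g_zero: "g t = 0" if "t \<in> {0..b}" for t
  proof (rule frac_int_extremal[OF \<alpha>(1) b g _ that])
    fix t assume t: "t \<in> {0..b}"
    show "t powr \<alpha> * \<bar>g t\<bar> \<le> Gamma (\<alpha> + 1) * \<bar>frac_int \<alpha> g t\<bar>"
      using assms(5)[OF t] by (simp add: g_eq[OF t] w_frac[OF t, symmetric] w_eq[OF t])
  qed
  have "w x = frac_int \<alpha> (\<lambda>_. 0) x"
    unfolding w_frac[OF x]
  proof (rule frac_int_cong)
    fix t assume "t < x"
    then show "g t = 0"
      using g_zero[of t] g(1) x by (cases "t \<le> 0") (auto simp: causal_bounded_def)
  qed
  then show "y x = z x"
    using w_eq[OF x] by (simp add: frac_int_def)
qed

end
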